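(* Let $n\ge 2$ be even. (i) There is a locally finite $n$-distributive variety which is not $(2n-1)$-reversed-modular; in particular, it is not $(2n-2)$-modular. (ii) There is a locally finite $n$-alvin variety which is not $(2n-3)$-modular.
   Context: All terms below are terms of a variety (or algebra) and equations are meant to hold identically. A sequence $t_0,\dots,t_n$ of ternary terms satisfies the basic equations (B) if $t_0(x,y,z)=x$, $t_n(x,y,z)=z$ and $t_h(x,y,x)=x$ for all $0\le h\le n$. - J\'onsson terms: (B) together with $t_h(x,x,z)=t_{h+1}(x,x,z)$ for even $h$ and $t_h(x,z,z)=t_{h+1}(x,z,z)$ for odd $h$, $0\le h<n$. - Alvin terms: (B) together with $t_h(x,z,z)=t_{h+1}(x,z,z)$ for even $h$ and $t_h(x,x,z)=t_{h+1}(x,x,z)$ for odd $h$, $0\le h<n$. A variety is $n$-distributive ($n$-alvin) if it has J\'onsson (alvin) terms $t_0,\dots,t_n$. Day terms: $4$-ary terms $u_0,\dots,u_m$ with $u_k(x,y,y,x)=x$ for all $0\le k\le m$, $u_0(x,y,z,w)=x$, $u_m(x,y,z,w)=w$, $u_k(x,x,w,w)=u_{k+1}(x,x,w,w)$ for even $k$ and $u_k(x,y,y,w)=u_{k+1}(x,y,y,w)$ for odd $k$ ($0\le k<m$). Reversed Day terms: the same but with "even" and "odd" exchanged in the last two conditions. A variety is $m$-modular ($m$-reversed-modular) if it has Day (reversed Day) terms $u_0,\dots,u_m$. *)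

theory Defs
  imports Main
begin

text \<open>A signature is given by an arity function ar :: nat => nat on the operation
symbols. Variables are natural numbers; variable i is x_i. A variety is presented
by a set of defining identities Sigma; by Birkhoff's theorem the identities holding
in the variety are exactly the equational consequences of Sigma, defined below by
the rules of equational logic.\<close>

datatype trm = Var nat | Op nat "trm list"

fun wf_trm :: "(nat \<Rightarrow> nat) \<Rightarrow> trm \<Rightarrow> bool" where
  "wf_trm ar (Var x) = True"
| "wf_trm ar (Op f ts) = (length ts = ar f \<and> (\<forall>t\<in>set ts. wf_trm ar t))"

fun vars :: "trm \<Rightarrow> nat set" where
  "vars (Var x) = {x}"
| "vars (Op f ts) = (\<Union>t\<in>set ts. vars t)"

fun subst :: "(nat \<Rightarrow> trm) \<Rightarrow> trm \<Rightarrow> trm" where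
  "subst \<sigma> (Var x) = \<sigma> x"
| "subst \<sigma> (Op f ts) = Op f (map (subst \<sigma>) ts)"

definition inst :: "trm \<Rightarrow> trm list \<Rightarrow> trm" where
  "inst t as = subst (\<lambda>i. if i < length as then as ! i else Var i) t"

abbreviation x\<^sub>v :: trm where "x\<^sub>v \<equiv> Var 0"
abbreviation y\<^sub>v :: trm where "y\<^sub>v \<equiv> Var 1"
abbreviation z\<^sub>v :: trm where "z\<^sub>v \<equiv> Var 2"
abbreviation w\<^sub>v :: trm where "w\<^sub>v \<equiv> Var 3"

definition wf_ids :: "(nat \<Rightarrow> nat) \<Rightarrow> (trm \<times> trm) set \<Rightarrow> bool" where
  "wf_ids ar \<Sigma> = (\<forall>(s,t)\<in>\<Sigma>. wf_trm ar s \<and> wf_trm ar t)"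

inductive eqc :: "(nat \<Rightarrow> nat) \<Rightarrow> (trm \<times> trm) set \<Rightarrow> trm \<Rightarrow> trm \<Rightarrow> bool"
  for ar \<Sigma> where
  ax: "(s, t) \<in> \<Sigma> \<Longrightarrow> eqc ar \<Sigma> s t"
| refl: "wf_trm ar t \<Longrightarrow> eqc ar \<Sigma> t t"
| sym: "eqc ar \<Sigma> s t \<Longrightarrow> eqc ar \<Sigma> t s"
| trans: "eqc ar \<Sigma> s t \<Longrightarrow> eqc ar \<Sigma> t u \<Longrightarrow> eqc ar \<Sigma> s u"
| subst: "eqc ar \<Sigma> s t \<Longrightarrow> (\<forall>x. wf_trm ar (\<sigma> x)) \<Longrightarrow>
          eqc ar \<Sigma> (subst \<sigma> s) (subst \<sigma> t)"
| cong: "length ss = ar f \<Longrightarrow> list_all2 (eqc ar \<Sigma>) ss ts \<Longrightarrow>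
          eqc ar \<Sigma> (Op f ss) (Op f ts)"

text \<open>Locally finite: every finitely generated free algebra F_V(k) is finite, i.e.
the k-variable terms fall into finitely many classes modulo the identities of V.\<close>
definition locally_finite :: "(nat \<Rightarrow> nat) \<Rightarrow> (trm \<times> trm) set \<Rightarrow> bool" where
  "locally_finite ar \<Sigma> =
    (\<forall>k. finite {{s. wf_trm ar s \<and> vars s \<subseteq> {..<k} \<and> eqc ar \<Sigma> t s} | t.
                  wf_trm ar t \<and> vars t \<subseteq> {..<k}})"

definition kary :: "(nat \<Rightarrow> nat) \<Rightarrow> nat \<Rightarrow> trm \<Rightarrow> bool" where
  "kary ar k t = (wf_trm ar t \<and> vars t \<subseteq> {..<k})"

definition basic_eqs :: "(nat \<Rightarrow> nat) \<Rightarrow> (trm \<times> trm) set \<Rightarrow> nat \<Rightarrow> (nat \<Rightarrow> trm) \<Rightarrow> bool" where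
  "basic_eqs ar \<Sigma> n t =
    ((\<forall>h\<le>n. kary ar 3 (t h)) \<and>
     eqc ar \<Sigma> (t 0) x\<^sub>v \<and> eqc ar \<Sigma> (t n) z\<^sub>v \<and>
     (\<forall>h\<le>n. eqc ar \<Sigma> (inst (t h) [x\<^sub>v, y\<^sub>v, x\<^sub>v]) x\<^sub>v))"

definition jonsson_terms :: "(nat \<Rightarrow> nat) \<Rightarrow> (trm \<times> trm) set \<Rightarrow> nat \<Rightarrow> (nat \<Rightarrow> trm) \<Rightarrow> bool" where
  "jonsson_terms ar \<Sigma> n t =
    (basic_eqs ar \<Sigma> n t \<and>
     (\<forall>h<n. (even h \<longrightarrow> eqc ar \<Sigma> (inst (t h) [x\<^sub>v, x\<^sub>v, z\<^sub>v]) (inst (t (Suc h)) [x\<^sub>v, x\<^sub>v, z\<^sub>v])) \<and>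
            (odd h \<longrightarrow> eqc ar \<Sigma> (inst (t h) [x\<^sub>v, z\<^sub>v, z\<^sub>v]) (inst (t (Suc h)) [x\<^sub>v, z\<^sub>v, z\<^sub>v]))))"

definition alvin_terms :: "(nat \<Rightarrow> nat) \<Rightarrow> (trm \<times> trm) set \<Rightarrow> nat \<Rightarrow> (nat \<Rightarrow> trm) \<Rightarrow> bool" where
  "alvin_terms ar \<Sigma> n t =
    (basic_eqs ar \<Sigma> n t \<and>
     (\<forall>h<n. (even h \<longrightarrow> eqc ar \<Sigma> (inst (t h) [x\<^sub>v, z\<^sub>v, z\<^sub>v]) (inst (t (Suc h)) [x\<^sub>v, z\<^sub>v, z\<^sub>v])) \<and>
            (odd h \<longrightarrow> eqc ar \<Sigma> (inst (t h) [x\<^sub>v, x\<^sub>v, z\<^sub>v]) (inst (t (Suc h)) [x\<^sub>v, x\<^sub>v, z\<^sub>v]))))"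

definition day_basic :: "(nat \<Rightarrow> nat) \<Rightarrow> (trm \<times> trm) set \<Rightarrow> nat \<Rightarrow> (nat \<Rightarrow> trm) \<Rightarrow> bool" where
  "day_basic ar \<Sigma> m u =
    ((\<forall>k\<le>m. kary ar 4 (u k)) \<and>
     (\<forall>k\<le>m. eqc ar \<Sigma> (inst (u k) [x\<^sub>v, y\<^sub>v, y\<^sub>v, x\<^sub>v]) x\<^sub>v) \<and>
     eqc ar \<Sigma> (u 0) x\<^sub>v \<and> eqc ar \<Sigma> (u m) w\<^sub>v)"

definition day_terms :: "(nat \<Rightarrow> nat) \<Rightarrow> (trm \<times> trm) set \<Rightarrow> nat \<Rightarrow> (nat \<Rightarrow> trm) \<Rightarrow> bool" where
  "day_terms ar \<Sigma> m u =
    (day_basic ar \<Sigma> m u \<and>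
     (\<forall>k<m. (even k \<longrightarrow> eqc ar \<Sigma> (inst (u k) [x\<^sub>v, x\<^sub>v, w\<^sub>v, w\<^sub>v]) (inst (u (Suc k)) [x\<^sub>v, x\<^sub>v, w\<^sub>v, w\<^sub>v])) \<and>
            (odd k \<longrightarrow> eqc ar \<Sigma> (inst (u k) [x\<^sub>v, y\<^sub>v, y\<^sub>v, w\<^sub>v]) (inst (u (Suc k)) [x\<^sub>v, y\<^sub>v, y\<^sub>v, w\<^sub>v]))))"

definition rev_day_terms :: "(nat \<Rightarrow> nat) \<Rightarrow> (trm \<times> trm) set \<Rightarrow> nat \<Rightarrow> (nat \<Rightarrow> trm) \<Rightarrow> bool" where
  "rev_day_terms ar \<Sigma> m u =
    (day_basic ar \<Sigma> m u \<and>
     (\<forall>k<m. (odd k \<longrightarrow> eqc ar \<Sigma> (inst (u k) [x\<^sub>v, x\<^sub>v, w\<^sub>v, w\<^sub>v]) (inst (u (Suc k)) [x\<^sub>v, x\<^sub>v, w\<^sub>v, w\<^sub>v])) \<and>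
            (even k \<longrightarrow> eqc ar \<Sigma> (inst (u k) [x\<^sub>v, y\<^sub>v, y\<^sub>v, w\<^sub>v]) (inst (u (Suc k)) [x\<^sub>v, y\<^sub>v, y\<^sub>v, w\<^sub>v]))))"

definition n_distributive where "n_distributive ar \<Sigma> n = (\<exists>t. jonsson_terms ar \<Sigma> n t)"
definition n_alvin where "n_alvin ar \<Sigma> n = (\<exists>t. alvin_terms ar \<Sigma> n t)"
definition m_modular where "m_modular ar \<Sigma> m = (\<exists>u. day_terms ar \<Sigma> m u)"
definition m_reversed_modular where "m_reversed_modular ar \<Sigma> m = (\<exists>u. rev_day_terms ar \<Sigma> m u)"

end

theory Submission
  imports Defs "HOL-Library.FuncSet"
begin

text \<open>Both varieties are generated by two-element algebras \<open>C\<^sub>1, \<dots>, C\<^sub>N\<close>, where \<open>n = 2N\<close>, with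
  ternary operations \<open>t\<^sub>0, \<dots>, t\<^sub>n\<close>. In \<open>C\<^sub>i\<close> the operations \<open>t\<^sub>h\<close> are the first projection for
  \<open>h < i\<close>, the third one for \<open>h > n - i\<close>, the meet \<open>xz\<close> strictly between \<open>i\<close> and \<open>n - i\<close>, while
  \<open>t\<^sub>i = x(y \<or> z)\<close> and \<open>t\<^sub>n\<^sub>-\<^sub>i = z(y \<or> x)\<close>, with \<open>y\<close> complemented on every other level \<open>i\<close>;
  in the central algebra \<open>t\<^sub>N\<close> is a majority or a Pixley operation.

  Whenever a term takes the value 1 in \<open>C\<^sub>i\<close> at two points having only one variable \<open>v\<close> in
  common support, it is the projection to \<open>v\<close> in every \<open>C\<^sub>j\<close> with \<open>j > i\<close>. Hence each level
  \<open>i < N\<close> forces terms at either end of a chain of Day terms to be projections on all later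
  levels: three terms at a level with \<open>y\<close> uncomplemented, one term otherwise. What is left
  of the chain is too short for the central algebra.\<close>

section \<open>Varieties generated by finitely many finite algebras\<close>

fun eval :: "(nat \<Rightarrow> 'a list \<Rightarrow> 'a) \<Rightarrow> (nat \<Rightarrow> 'a) \<Rightarrow> trm \<Rightarrow> 'a" where
  "eval I e (Var x) = e x"
| "eval I e (Op f ts) = I f (map (eval I e) ts)"

lemma eval_subst: "eval I e (subst \<sigma> t) = eval I (\<lambda>x. eval I e (\<sigma> x)) t"
  by (induction t) (auto intro!: arg_cong[where f = "I _"])

lemma eval_inst:
  "eval I e (inst t as) = eval I (\<lambda>x. if x < length as then eval I e (as ! x) else e x) t"
  by (auto simp: inst_def eval_subst intro!: arg_cong[where f = "\<lambda>e. eval I e t"])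

lemma eval_cong: "(\<And>x. x \<in> vars t \<Longrightarrow> e x = e' x) \<Longrightarrow> eval I e t = eval I e' t"
proof (induction t)
  case (Op f ts)
  then have "map (eval I e) ts = map (eval I e') ts"
    by (intro map_cong) auto
  then show ?case by (simp only: eval.simps)
qed simp

text \<open>The whole equational theory of the algebras serves as the axiom set. Derivability
  between well-formed terms is then validity: soundness is an induction on derivations, the converse
  is the axiom rule.\<close>

definition identities ::
  "(nat \<Rightarrow> nat) \<Rightarrow> ('i \<Rightarrow> nat \<Rightarrow> 'a list \<Rightarrow> 'a) \<Rightarrow> 'i set \<Rightarrow> (trm \<times> trm) set" where
  "identities ar I A =
    {(s, t). wf_trm ar s \<and> wf_trm ar t \<and> (\<forall>i\<in>A. \<forall>e. eval (I i) e s = eval (I i) e t)}"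

lemma wf_ids_identities: "wf_ids ar (identities ar I A)"
  by (auto simp: wf_ids_def identities_def)

lemma eqc_identities_sound:
  assumes "eqc ar (identities ar I A) s t" and "i \<in> A"
  shows "eval (I i) e s = eval (I i) e t"
  using assms(1)
proof (induction arbitrary: e rule: eqc.induct)
  case (ax s t)
  with assms(2) show ?case by (auto simp: identities_def)
next
  case (cong ss f ts)
  then have "map (eval (I i) e) ss = map (eval (I i) e) ts"
    by (auto simp: list_all2_conv_all_nth intro!: nth_equalityI)
  then show ?case by (simp only: eval.simps)
qed (auto simp: eval_subst)

lemma eqc_identitiesI:
  assumes "wf_trm ar s" "wf_trm ar t" "\<And>i e. i \<in> A \<Longrightarrow> eval (I i) e s = eval (I i) e t"
  shows "eqc ar (identities ar I A) s t"
  using assms by (intro eqc.ax) (auto simp: identities_def)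

text \<open>Modulo the identities, a term \<open>t\<close> in \<open>k\<close> variables is
  determined by its value table \<open>\<phi> t\<close> over all pairs of an algebra and an
  assignment to these variables, and only finitely many tables exist.\<close>

lemma locally_finite_identities:
  fixes I :: "'i \<Rightarrow> nat \<Rightarrow> 'a::finite list \<Rightarrow> 'a"
  assumes "finite A"
  shows "locally_finite ar (identities ar I A)"
  unfolding locally_finite_def
proof
  fix k :: nat
  define P where "P = A \<times> (PiE {..<k} (\<lambda>_. UNIV :: 'a set))"
  define \<phi> where "\<phi> t = (\<lambda>(i, e). (i, e, eval (I i) e t)) ` P" for t
  define F where "F X = {s. wf_trm ar s \<and> vars s \<subseteq> {..<k} \<and> \<phi> s = X}" for X
  have \<phi>_eq: "eqc ar (identities ar I A) t s \<longleftrightarrow> \<phi> s = \<phi> t"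
    if t: "wf_trm ar t" "vars t \<subseteq> {..<k}" and s: "wf_trm ar s" "vars s \<subseteq> {..<k}" for s t
  proof
    assume "eqc ar (identities ar I A) t s"
    then show "\<phi> s = \<phi> t"
      unfolding \<phi>_def P_def by (intro image_cong) (auto dest: eqc_identities_sound[symmetric])
  next
    assume eq: "\<phi> s = \<phi> t"
    show "eqc ar (identities ar I A) t s"
    proof (rule eqc_identitiesI)
      fix i and e :: "nat \<Rightarrow> 'a"
      assume i: "i \<in> A"
      \<comment> \<open>Cutting \<open>e\<close> down to the first \<open>k\<close> variables makes
        it an entry of the table and keeps the values of \<open>s\<close> and
        \<open>t\<close>.\<close>
      let ?e = "restrict e {..<k}"
      have "(i, ?e) \<in> P"
        using i by (auto simp: P_def)
      then have "(i, ?e, eval (I i) ?e t) \<in> \<phi> t"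
        unfolding \<phi>_def by (auto intro: image_eqI[where x = "(i, ?e)"])
      then have "eval (I i) ?e t = eval (I i) ?e s"
        unfolding eq[symmetric] by (auto simp: \<phi>_def)
      moreover have "eval (I i) ?e t = eval (I i) e t" "eval (I i) ?e s = eval (I i) e s"
        using t s by (auto intro!: eval_cong)
      ultimately show "eval (I i) e t = eval (I i) e s" by simp
    qed (use t s in auto)
  qed
  have "finite P"
    unfolding P_def using assms by (intro finite_cartesian_product finite_PiE) auto
  then have "finite (F ` Pow ((\<lambda>((i, e), a). (i, e, a)) ` (P \<times> (UNIV :: 'a set))))"
    by simp
  moreover have "{{s. wf_trm ar s \<and> vars s \<subseteq> {..<k} \<and> eqc ar (identities ar I A) t s} | t.
                  wf_trm ar t \<and> vars t \<subseteq> {..<k}}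
       \<subseteq> F ` Pow ((\<lambda>((i, e), a). (i, e, a)) ` (P \<times> UNIV))" (is "?L \<subseteq> ?R")
  proof
    fix X assume "X \<in> ?L"
    then obtain t where t: "wf_trm ar t" "vars t \<subseteq> {..<k}"
      and X: "X = {s. wf_trm ar s \<and> vars s \<subseteq> {..<k} \<and> eqc ar (identities ar I A) t s}"
      by blast
    have "X = F (\<phi> t)"
      unfolding X F_def using \<phi>_eq[OF t] by blast
    moreover have "\<phi> t \<in> Pow ((\<lambda>((i, e), a). (i, e, a)) ` (P \<times> UNIV))"
      unfolding \<phi>_def by force
    ultimately show "X \<in> ?R" by blast
  qed
  ultimately show "finite ?L"
    by (rule rev_finite_subset)
qed

section \<open>The two-element algebras\<close>

text \<open>The flag \<open>J\<close> selects the Jonsson (true) or the alvin (false) version; \<open>y\<close> is left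
  uncomplemented on the levels \<open>i\<close> with \<open>odd i = J\<close>.\<close>

definition level_op :: "bool \<Rightarrow> nat \<Rightarrow> nat \<Rightarrow> nat \<Rightarrow> bool list \<Rightarrow> bool" where
  "level_op J N i h xs =
    (let a = xs ! 0; b = (xs ! 1 = (odd i = J)); c = xs ! 2 in
     if h < i then a
     else if 2 * N < h + i then c
     else if i = N then (if a = c then a else b)
     else if h = i then a \<and> (b \<or> c)
     else if h + i = 2 * N then c \<and> (b \<or> a)
     else a \<and> c)"

abbreviation level_ids :: "bool \<Rightarrow> nat \<Rightarrow> (trm \<times> trm) set" where
  "level_ids J N \<equiv> identities (\<lambda>_. 3) (level_op J N) {1..N}"

section \<open>Jonsson and alvin terms of the generated varieties\<close>

definition level_term :: "nat \<Rightarrow> trm" where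
  "level_term h = Op h [x\<^sub>v, y\<^sub>v, z\<^sub>v]"

lemma eval_level_term:
  "eval I e (inst (level_term h) [Var p, Var q, Var r]) = I h [e p, e q, e r]"
  by (simp add: level_term_def eval_inst)

lemma wf_inst_level_term: "wf_trm (\<lambda>_. 3) (inst (level_term h) [Var p, Var q, Var r])"
  by (simp add: level_term_def inst_def)

lemma level_op_idem: "level_op J N i h [a, b, a] = a"
  by (auto simp: level_op_def Let_def)

lemma level_position_cases:
  fixes i h N :: nat
  assumes "i \<in> {1..N}"
  obtains "Suc h < i" | "Suc h = i" "odd i = even h" "h + i < 2 * N"
    | "h = i" "Suc h + i \<noteq> 2 * N" "h + i < 2 * N \<longleftrightarrow> i \<noteq> N"
    | "i < h" "Suc h + i < 2 * N" "i \<noteq> N"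
    | "i < h" "Suc h + i = 2 * N" "i \<noteq> N" "odd i = even h"
    | "i < h" "h + i = 2 * N" "i \<noteq> N" "even i = even h" | "i < h" "2 * N < h + i"
proof -
  have "Suc h < i \<or> Suc h = i \<or> h = i \<or> i < h \<and> Suc h + i < 2 * N \<or> i < h \<and> Suc h + i = 2 * N \<or>
      i < h \<and> h + i = 2 * N \<or> i < h \<and> 2 * N < h + i"
    by linarith
  moreover have "odd i = even h" if "Suc h + i = 2 * N"
    using arg_cong[OF that, of even] by simp
  moreover have "even i = even h" if "h + i = 2 * N"
    using arg_cong[OF that, of even] by simp
  moreover have "Suc (i + i) \<noteq> 2 * N" "i + i < 2 * N \<longleftrightarrow> i \<noteq> N"
    using assms by (presburger, auto)
  ultimately show ?thesis
    using assms that by auto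
qed

text \<open>The operation changes only near \<open>h = i\<close> and \<open>h = 2 * N - i\<close>.
  By parity, \<open>y\<close> is plain when \<open>h + 1\<close> is one of these places and
  complemented when \<open>h\<close> is. For \<open>i < N\<close> the steps at \<open>i\<close> thus
  read x(x \<or> z) = x and x(x' \<or> z) = xz; for \<open>i = N\<close> the operation is a majority
  on entering and a Pixley operation on leaving.\<close>

lemma level_op_left:
  assumes "i \<in> {1..N}" "even h = J"
  shows "level_op J N i h [a, a, c] = level_op J N i (Suc h) [a, a, c]"
  by (cases rule: level_position_cases[OF assms(1), of h]) (use assms in \<open>auto simp: level_op_def Let_def\<close>)

lemma level_op_right:
  assumes "i \<in> {1..N}" "even h \<noteq> J"
  shows "level_op J N i h [a, c, c] = level_op J N i (Suc h) [a, c, c]"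
  by (cases rule: level_position_cases[OF assms(1), of h]) (use assms in \<open>auto simp: level_op_def Let_def\<close>)

lemma basic_eqs_level: "basic_eqs (\<lambda>_. 3) (level_ids J N) (2 * N) level_term"
  unfolding basic_eqs_def
  by (auto simp: kary_def eval_level_term wf_inst_level_term level_op_idem intro!: eqc_identitiesI)
     (auto simp: level_term_def level_op_def)

lemma jonsson_terms_level: "jonsson_terms (\<lambda>_. 3) (level_ids True N) (2 * N) level_term"
  unfolding jonsson_terms_def using basic_eqs_level[of True N]
  by (auto simp: eval_level_term wf_inst_level_term level_op_left level_op_right
      intro!: eqc_identitiesI)

lemma alvin_terms_level: "alvin_terms (\<lambda>_. 3) (level_ids False N) (2 * N) level_term"
  unfolding alvin_terms_def using basic_eqs_level[of False N]
  by (auto simp: eval_level_term wf_inst_level_term level_op_left level_op_right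
      intro!: eqc_identitiesI)

section \<open>Monotonicity and forced projections\<close>

lemma length_3_conv: "length xs = 3 \<Longrightarrow> \<exists>a b c. xs = [a, b, c]"
  by (auto simp: numeral_3_eq_3 length_Suc_conv)

text \<open>On these levels no complement occurs: all operations are projections, lattice
  polynomials or the majority.\<close>

lemma level_op_mono:
  assumes "odd i = J" "a \<longrightarrow> a'" "b \<longrightarrow> b'" "c \<longrightarrow> c'"
  shows "level_op J N i h [a, b, c] \<longrightarrow> level_op J N i h [a', b', c']"
proof -
  have b: "(x = (odd i = J)) = x" for x
    using assms(1) by simp
  show ?thesis
    unfolding level_op_def Let_def b using assms(2-)
    by (cases a; cases b; cases c; cases a'; cases b'; cases c'; simp)
qed

lemma eval_level_mono:
  assumes "wf_trm (\<lambda>_. 3) t" "odd i = J" "\<And>v. e v \<Longrightarrow> e' v" "eval (level_op J N i) e t"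
  shows "eval (level_op J N i) e' t"
  using assms
proof (induction t)
  case (Op h ts)
  have "length ts = 3"
    using Op.prems(1) by simp
  then obtain p q r where ts: "ts = [p, q, r]"
    using length_3_conv by blast
  have "eval (level_op J N i) e s \<longrightarrow> eval (level_op J N i) e' s" if "s \<in> {p, q, r}" for s
    using Op.IH[of s] Op.prems(1-3) that unfolding ts by auto
  then have "level_op J N i h (map (eval (level_op J N i) e) ts) \<longrightarrow>
      level_op J N i h (map (eval (level_op J N i) e') ts)"
    unfolding ts list.map by (intro level_op_mono Op.prems(2)) auto
  then show ?case
    using Op.prems(4) by simp
qed simp

lemma level_op_first: "h < i \<Longrightarrow> level_op J N i h [a, b, c] = a"
  by (simp add: level_op_def)

lemma level_op_third: "i \<le> N \<Longrightarrow> 2 * N < h + i \<Longrightarrow> level_op J N i h [a, b, c] = c"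
  by (simp add: level_op_def)

lemma level_op_le_left: "i < N \<Longrightarrow> h \<le> i \<Longrightarrow> level_op J N i h [a, b, c] \<Longrightarrow> a"
  by (auto simp: level_op_def Let_def split: if_splits)

lemma level_op_le_right: "i < N \<Longrightarrow> 2 * N \<le> h + i \<Longrightarrow> level_op J N i h [a, b, c] \<Longrightarrow> c"
  by (auto simp: level_op_def Let_def split: if_splits)

lemma level_op_meet: "i < h \<Longrightarrow> h + i < 2 * N \<Longrightarrow> level_op J N i h [a, b, c] = (a \<and> c)"
  by (auto simp: level_op_def Let_def)

text \<open>Induction on the term. For \<open>h \<le> i\<close> a value 1 on level \<open>i\<close>
  passes to the first argument, and on level \<open>j\<close> the operation is the first projection;
  \<open>h \<ge> 2 * N - i\<close> is symmetric. In between both outer arguments have value 1, hence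
  both are the projection to \<open>v\<^sub>0\<close> on level \<open>j\<close>, and
  \<open>t\<^sub>h(a, b, a) = a\<close> applies.\<close>

lemma eval_level_projection:
  assumes "wf_trm (\<lambda>_. 3) t" "i < j" "j \<le> N"
    and "eval (level_op J N i) e t" "eval (level_op J N i) e' t"
    and "\<And>v. e v \<Longrightarrow> e' v \<Longrightarrow> v = v\<^sub>0"
  shows "eval (level_op J N j) d t = d v\<^sub>0"
  using assms
proof (induction t)
  case (Op h ts)
  have "length ts = 3"
    using Op.prems(1) by simp
  then obtain p q r where ts: "ts = [p, q, r]"
    using length_3_conv by blast
  let ?C = "eval (level_op J N i)" and ?D = "eval (level_op J N j) d"
  have p: "?D p = d v\<^sub>0" if "?C e p" "?C e' p"
    using that Op unfolding ts by simp
  have r: "?D r = d v\<^sub>0" if "?C e r" "?C e' r"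
    using that Op unfolding ts by simp
  consider "h \<le> i" | "i < h" "h + i < 2 * N" | "2 * N \<le> h + i"
    by linarith
  then show ?case
  proof cases
    case 1
    then have "?C e p" "?C e' p"
      using Op.prems level_op_le_left[of i N h] unfolding ts by auto
    with 1 Op.prems(2,3) p show ?thesis
      unfolding ts by (simp add: level_op_first)
  next
    case 2
    then have "?C e p" "?C e' p" "?C e r" "?C e' r"
      using Op.prems unfolding ts by (auto simp: level_op_meet)
    with p r show ?thesis
      unfolding ts by (simp add: level_op_idem)
  next
    case 3
    then have "?C e r" "?C e' r"
      using Op.prems level_op_le_right[of i N h] unfolding ts by auto
    with 3 Op.prems(2,3) r show ?thesis
      unfolding ts by (simp add: level_op_third)
  qed
qed simp

section \<open>Chains of Day terms\<close>

text \<open>The number of terms at either end of the chain that the levels \<open>1, \<dots>, i\<close> use up.\<close>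

definition peeled :: "bool \<Rightarrow> nat \<Rightarrow> nat" where
  "peeled J i = (if even i then 2 * i else if J then 2 * i + 1 else 2 * i - 1)"

text \<open>The parity tells which Day equation links the last peeled term to the next: here the one
  at (a, b, b, d), on the complemented levels the one at (a, a, d, d).\<close>

lemma peeled_Suc_mono:
  "odd (Suc i) = J \<Longrightarrow> peeled J (Suc i) = peeled J i + 3 \<and> even (peeled J i) = J"
  by (cases J) (auto simp: peeled_def elim!: oddE)

lemma peeled_Suc_compl:
  "odd (Suc i) \<noteq> J \<Longrightarrow> peeled J (Suc i) = peeled J i + 1 \<and> even (peeled J i) \<noteq> J"
  by (cases J) (auto simp: peeled_def elim!: oddE)

text \<open>Below, \<open>g i k a b c d\<close> is the value at \<open>(a, b, c, d)\<close> of the \<open>k\<close>-th term in the \<open>i\<close>-th algebra.\<close>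

lemma chain_start:
  fixes g :: "nat \<Rightarrow> nat \<Rightarrow> bool \<Rightarrow> bool \<Rightarrow> bool \<Rightarrow> bool \<Rightarrow> bool"
  assumes start: "\<And>i a b c d. i \<in> {1..N} \<Longrightarrow> g i 0 a b c d = a"
    and diag: "\<And>i k a b. i \<in> {1..N} \<Longrightarrow> k \<le> m \<Longrightarrow> g i k a b b a = a"
    and inner: "\<And>i k a b d. i \<in> {1..N} \<Longrightarrow> k < m \<Longrightarrow> even k = J \<Longrightarrow>
                  g i k a b b d = g i (Suc k) a b b d"
    and outer: "\<And>i k a d. i \<in> {1..N} \<Longrightarrow> k < m \<Longrightarrow> even k \<noteq> J \<Longrightarrow>
                  g i k a a d d = g i (Suc k) a a d d"
    and mono: "\<And>i k a b c d a' b' c' d'. odd i = J \<Longrightarrow> k \<le> m \<Longrightarrow> a \<longrightarrow> a' \<Longrightarrow> b \<longrightarrow> b' \<Longrightarrow>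
                  c \<longrightarrow> c' \<Longrightarrow> d \<longrightarrow> d' \<Longrightarrow> g i k a b c d \<Longrightarrow> g i k a' b' c' d'"
    and proj: "\<And>i j k p a b c d. i < j \<Longrightarrow> j \<le> N \<Longrightarrow> k \<le> m \<Longrightarrow> g i k True True p False \<Longrightarrow>
                  g i k True False False True \<Longrightarrow> g j k a b c d = a"
    and "i < j" "j \<le> N" "peeled J i \<le> m"
  shows "g j (peeled J i) a b c d = a"
  using assms(7-)
proof (induction i arbitrary: j a b c d)
  case 0
  then show ?case by (simp add: peeled_def start)
next
  case (Suc i)
  let ?k = "peeled J i"
  have lev: "Suc i \<in> {1..N}" using Suc.prems by simp
  show ?case
  proof (cases "odd (Suc i) = J")
    case True
    note k = peeled_Suc_mono[OF True]
    have km: "?k + 3 \<le> m" using Suc.prems k by simp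
    have IH: "g (Suc i) ?k a b c d = a" for a b c d
      using Suc.IH[of "Suc i"] Suc.prems km by simp
    \<comment> \<open>The value 1 is carried along three links; between them monotonicity raises the
      point from 1000 to 1100 and then to 1110, so that the next link applies.\<close>
    have "g (Suc i) (?k + 1) True False False False"
      using inner[OF lev, of ?k True False False] IH k km by simp
    then have "g (Suc i) (?k + 1) True True False False"
      using mono[OF True, of "?k + 1" True True False True False False False False] km by simp
    then have "g (Suc i) (?k + 2) True True False False"
      using outer[OF lev, of "?k + 1" True False] k km by simp
    then have "g (Suc i) (?k + 2) True True True False"
      using mono[OF True, of "?k + 2" True True True True False True False False] km by simp
    then have "g (Suc i) (?k + 3) True True True False"
      using inner[OF lev, of "?k + 2" True True False] k km by (simp add: numeral_3_eq_3)
    moreover have "g (Suc i) (?k + 3) True False False True"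
      using diag[OF lev] km by simp
    ultimately show ?thesis
      using proj[of "Suc i" j "?k + 3" True] Suc.prems k km by simp
  next
    case False
    note k = peeled_Suc_compl[OF False]
    have km: "?k + 1 \<le> m" using Suc.prems k by simp
    have IH: "g (Suc i) ?k a b c d = a" for a b c d
      using Suc.IH[of "Suc i"] Suc.prems km by simp
    \<comment> \<open>Without monotonicity a single link, at 1100, is usable.\<close>
    have "g (Suc i) (?k + 1) True True False False"
      using outer[OF lev, of ?k True False] IH k km by simp
    moreover have "g (Suc i) (?k + 1) True False False True"
      using diag[OF lev] km by simp
    ultimately show ?thesis
      using proj[of "Suc i" j "?k + 1" False] Suc.prems k km by simp
  qed
qed

text \<open>Peeling from both ends makes the terms \<open>k\<close> and \<open>m - k\<close> the
  first and the last projection on level \<open>N\<close>. They are three links apart if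
  \<open>y\<close> is plain there and one link otherwise, too few to join them.\<close>

lemma no_short_chain:
  fixes g :: "nat \<Rightarrow> nat \<Rightarrow> bool \<Rightarrow> bool \<Rightarrow> bool \<Rightarrow> bool \<Rightarrow> bool"
  assumes "N \<ge> 1" and m: "m = (if J then 4 * N - 1 else 4 * N - 3)"
    and start: "\<And>i a b c d. i \<in> {1..N} \<Longrightarrow> g i 0 a b c d = a"
    and stop: "\<And>i a b c d. i \<in> {1..N} \<Longrightarrow> g i m a b c d = d"
    and diag: "\<And>i k a b. i \<in> {1..N} \<Longrightarrow> k \<le> m \<Longrightarrow> g i k a b b a = a"
    and inner: "\<And>i k a b d. i \<in> {1..N} \<Longrightarrow> k < m \<Longrightarrow> even k = J \<Longrightarrow>
                  g i k a b b d = g i (Suc k) a b b d"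
    and outer: "\<And>i k a d. i \<in> {1..N} \<Longrightarrow> k < m \<Longrightarrow> even k \<noteq> J \<Longrightarrow>
                  g i k a a d d = g i (Suc k) a a d d"
    and mono: "\<And>i k a b c d a' b' c' d'. odd i = J \<Longrightarrow> k \<le> m \<Longrightarrow> a \<longrightarrow> a' \<Longrightarrow> b \<longrightarrow> b' \<Longrightarrow>
                  c \<longrightarrow> c' \<Longrightarrow> d \<longrightarrow> d' \<Longrightarrow> g i k a b c d \<Longrightarrow> g i k a' b' c' d'"
    and proj_left: "\<And>i j k p a b c d. i < j \<Longrightarrow> j \<le> N \<Longrightarrow> k \<le> m \<Longrightarrow> g i k True True p False \<Longrightarrow>
                  g i k True False False True \<Longrightarrow> g j k a b c d = a"
    and proj_right: "\<And>i j k p a b c d. i < j \<Longrightarrow> j \<le> N \<Longrightarrow> k \<le> m \<Longrightarrow> g i k False p True True \<Longrightarrow>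
                  g i k True False False True \<Longrightarrow> g j k a b c d = d"
  shows False
proof -
  define k where "k = peeled J (N - 1)"
  have lev: "N \<in> {1..N}" using \<open>N \<ge> 1\<close> by simp
  have "odd m" using m \<open>N \<ge> 1\<close> by (auto simp: even_diff_nat)
  have "k \<le> m"
    using m \<open>N \<ge> 1\<close> by (auto simp: k_def peeled_def)
  have left: "g N k a b c d = a" for a b c d
    unfolding k_def
    by (rule chain_start[where g = g and m = m and N = N and J = J,
          OF start diag inner outer mono proj_left])
       (use \<open>N \<ge> 1\<close> \<open>k \<le> m\<close> in \<open>auto simp: k_def\<close>)
  \<comment> \<open>Reversing both the chain and the arguments gives a chain of the same kind:
    \<open>m\<close> is odd, so link \<open>k\<close> becomes link \<open>m - 1 - k\<close> of equal
    parity.\<close>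
  have right: "g N (m - k) a b c d = d" for a b c d
    unfolding k_def
  proof (rule chain_start[where g = "\<lambda>i k a b c d. g i (m - k) d c b a" and m = m and N = N and J = J])
    fix i k a b d
    assume i: "i \<in> {1..N}" and k: "k < m" "even k = J"
    have "m - k = Suc (m - Suc k)" using k by simp
    moreover have "even (m - Suc k) = J" using k \<open>odd m\<close> by (auto simp: even_diff_nat)
    ultimately show "g i (m - k) d b b a = g i (m - Suc k) d b b a"
      using inner[OF i, of "m - Suc k" d b a] k by simp
  next
    fix i k a d
    assume i: "i \<in> {1..N}" and k: "k < m" "even k \<noteq> J"
    have "m - k = Suc (m - Suc k)" using k by simp
    moreover have "even (m - Suc k) \<noteq> J" using k \<open>odd m\<close> by (auto simp: even_diff_nat)
    ultimately show "g i (m - k) d d a a = g i (m - Suc k) d d a a"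
      using outer[OF i, of "m - Suc k" d a] k by simp
  next
    fix i k a b c d a' b' c' d'
    assume "odd i = J" "a \<longrightarrow> a'" "b \<longrightarrow> b'" "c \<longrightarrow> c'" "d \<longrightarrow> d'" "g i (m - k) d c b a"
    then show "g i (m - k) d' c' b' a'"
      using mono[of i "m - k" d d' c c' b b' a a'] by simp
  next
    fix i j k p a b c d
    assume "i < j" "j \<le> N" "g i (m - k) False p True True" "g i (m - k) True False False True"
    then show "g j (m - k) d c b a = a"
      using proj_right[of i j "m - k" p] by simp
  qed (use stop diag \<open>N \<ge> 1\<close> \<open>k \<le> m\<close> in \<open>auto simp: k_def\<close>)
  show False
  proof (cases "odd N = J")
    case True
    then have k: "even k = J" and mk: "m = 2 * k + 3"
      using peeled_Suc_mono[of "N - 1" J] \<open>N \<ge> 1\<close> m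
      by (auto simp: k_def peeled_def)
    \<comment> \<open>The same climb to 1110 now ends at \<open>k + 3 = m - k\<close>, the last
      projection, whose value there is 0.\<close>
    have "g N (k + 1) True False False False"
      using inner[OF lev, of k True False False] left k mk by simp
    then have "g N (k + 1) True True False False"
      using mono[OF True, of "k + 1" True True False True False False False False] mk by simp
    then have "g N (k + 2) True True False False"
      using outer[OF lev, of "k + 1" True False] k mk by simp
    then have "g N (k + 2) True True True False"
      using mono[OF True, of "k + 2" True True True True False True False False] mk by simp
    then have "g N (k + 3) True True True False"
      using inner[OF lev, of "k + 2" True True False] k mk by (simp add: numeral_3_eq_3)
    then show False
      using right[of True True True False] mk by simp
  next
    case False
    then have k: "even k \<noteq> J" and mk: "m = 2 * k + 1"
      using peeled_Suc_compl[of "N - 1" J] \<open>N \<ge> 1\<close> m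
      by (auto simp: k_def peeled_def)
    then have "g N (Suc k) True True False False = False"
      using right[of True True False False] by simp
    then show False
      using outer[OF lev, of k True False] left k mk by simp
  qed
qed

section \<open>From Day terms to chains of Boolean operations\<close>

text \<open>Being false from the fifth variable on confines common supports to the first four
  variables, as the projection argument requires.\<close>

definition point :: "bool \<Rightarrow> bool \<Rightarrow> bool \<Rightarrow> bool \<Rightarrow> nat \<Rightarrow> bool" where
  "point a b c d v = (v = 0 \<and> a \<or> v = 1 \<and> b \<or> v = 2 \<and> c \<or> v = 3 \<and> d)"

lemma eval_inst_point:
  "eval I (point a b c d) (inst t [Var p, Var q, Var r, Var s]) =
   eval I (point (point a b c d p) (point a b c d q) (point a b c d r) (point a b c d s)) t"
  unfolding eval_inst
  by (rule arg_cong[where f = "\<lambda>e. eval I e t"])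
     (auto simp: fun_eq_iff point_def nth_Cons numeral_eq_Suc less_Suc_eq split: nat.split)

text \<open>\<open>J\<close> fixes both the algebras and the order of the links: true stands for
  reversed Day terms, false for Day terms.\<close>

lemma level_no_day_chain:
  assumes "N \<ge> 1" and m: "m = (if J then 4 * N - 1 else 4 * N - 3)"
    and basic: "day_basic (\<lambda>_. 3) (level_ids J N) m u"
    and inner: "\<And>k. k < m \<Longrightarrow> even k = J \<Longrightarrow>
      eqc (\<lambda>_. 3) (level_ids J N) (inst (u k) [x\<^sub>v, y\<^sub>v, y\<^sub>v, w\<^sub>v]) (inst (u (Suc k)) [x\<^sub>v, y\<^sub>v, y\<^sub>v, w\<^sub>v])"
    and outer: "\<And>k. k < m \<Longrightarrow> even k \<noteq> J \<Longrightarrow>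
      eqc (\<lambda>_. 3) (level_ids J N) (inst (u k) [x\<^sub>v, x\<^sub>v, w\<^sub>v, w\<^sub>v]) (inst (u (Suc k)) [x\<^sub>v, x\<^sub>v, w\<^sub>v, w\<^sub>v])"
  shows False
proof -
  let ?g = "\<lambda>i k a b c d. eval (level_op J N i) (point a b c d) (u k)"
  have wf: "wf_trm (\<lambda>_. 3) (u k)" if "k \<le> m" for k
    using basic that by (auto simp: day_basic_def kary_def)
  show False
  proof (rule no_short_chain[where g = ?g, OF assms(1,2)])
    fix i k a b c d
    assume i: "i \<in> {1..N}"
    have "eqc (\<lambda>_. 3) (level_ids J N) (u 0) x\<^sub>v" "eqc (\<lambda>_. 3) (level_ids J N) (u m) w\<^sub>v"
      using basic by (auto simp: day_basic_def)
    from this[THEN eqc_identities_sound, OF i]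
    show "?g i 0 a b c d = a" "?g i m a b c d = d"
      by (simp_all add: point_def)
    show "?g i k a b b a = a" if "k \<le> m"
    proof -
      have "eqc (\<lambda>_. 3) (level_ids J N) (inst (u k) [x\<^sub>v, y\<^sub>v, y\<^sub>v, x\<^sub>v]) x\<^sub>v"
        using basic that by (auto simp: day_basic_def)
      from eqc_identities_sound[OF this i, of "point a b b a"] show ?thesis
        by (simp add: eval_inst_point) (simp add: point_def)
    qed
    show "?g i k a b b d = ?g i (Suc k) a b b d" if "k < m" "even k = J"
      using eqc_identities_sound[OF inner[OF that] i, of "point a b b d"]
      by (simp add: eval_inst_point) (simp add: point_def)
    show "?g i k a a d d = ?g i (Suc k) a a d d" if "k < m" "even k \<noteq> J"
      using eqc_identities_sound[OF outer[OF that] i, of "point a a d d"]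
      by (simp add: eval_inst_point) (simp add: point_def)
  next
    fix i k a b c d a' b' c' d'
    assume "odd i = J" "k \<le> m" "a \<longrightarrow> a'" "b \<longrightarrow> b'" "c \<longrightarrow> c'" "d \<longrightarrow> d'" "?g i k a b c d"
    then show "?g i k a' b' c' d'"
      using eval_level_mono[OF wf[OF \<open>k \<le> m\<close>] \<open>odd i = J\<close>, of "point a b c d" "point a' b' c' d'" N]
      by (auto simp: point_def)
  next
    fix i j k p a b c d
    assume *: "i < j" "j \<le> N" "k \<le> m" "?g i k True True p False" "?g i k True False False True"
    show "?g j k a b c d = a"
      by (subst eval_level_projection[OF wf[OF *(3)] *(1,2,4,5), of 0]) (auto simp: point_def)
  next
    fix i j k p a b c d
    assume *: "i < j" "j \<le> N" "k \<le> m" "?g i k False p True True" "?g i k True False False True"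
    show "?g j k a b c d = d"
      by (subst eval_level_projection[OF wf[OF *(3)] *(1,2,4,5), of 3]) (auto simp: point_def)
  qed
qed

section \<open>Passing from modular to reversed-modular; the two varieties\<close>

lemma eqc_inst:
  assumes "eqc ar \<Sigma> s t" "\<And>a. a \<in> set as \<Longrightarrow> wf_trm ar a"
  shows "eqc ar \<Sigma> (inst s as) (inst t as)"
  unfolding inst_def using assms by (intro eqc.subst) auto

text \<open>Putting \<open>x\<close> in front of the chain shifts all indices by one and so
  exchanges even and odd; the new link 0 holds because \<open>u 0\<close> is
  \<open>x\<close>.\<close>

lemma reversed_modular_Suc_if_modular:
  assumes "m_modular ar \<Sigma> m"
  shows "m_reversed_modular ar \<Sigma> (Suc m)"
proof -
  obtain u where u: "day_terms ar \<Sigma> m u"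
    using assms by (auto simp: m_modular_def)
  have u0: "eqc ar \<Sigma> (u 0) x\<^sub>v"
    using u by (auto simp: day_terms_def day_basic_def)
  have "eqc ar \<Sigma> (inst x\<^sub>v [x\<^sub>v, y\<^sub>v, y\<^sub>v, w\<^sub>v]) (inst (u 0) [x\<^sub>v, y\<^sub>v, y\<^sub>v, w\<^sub>v])"
    by (rule eqc_inst[OF eqc.sym[OF u0]]) auto
  moreover have "kary ar 4 x\<^sub>v" "eqc ar \<Sigma> x\<^sub>v x\<^sub>v" "inst x\<^sub>v [x\<^sub>v, y\<^sub>v, y\<^sub>v, x\<^sub>v] = x\<^sub>v"
    by (auto simp: kary_def inst_def intro: eqc.refl)
  ultimately have "rev_day_terms ar \<Sigma> (Suc m) (\<lambda>k. case k of 0 \<Rightarrow> x\<^sub>v | Suc k \<Rightarrow> u k)"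
    using u by (auto simp: rev_day_terms_def day_terms_def day_basic_def split: nat.split)
  then show ?thesis
    by (auto simp: m_reversed_modular_def)
qed

theorem theorem4p1:
  fixes n :: nat
  assumes "n \<ge> 2" and "even n"
  shows "(\<exists>ar \<Sigma>. wf_ids ar \<Sigma> \<and> locally_finite ar \<Sigma> \<and> n_distributive ar \<Sigma> n \<and>
            \<not> m_reversed_modular ar \<Sigma> (2 * n - 1) \<and> \<not> m_modular ar \<Sigma> (2 * n - 2)) \<and>
         (\<exists>ar \<Sigma>. wf_ids ar \<Sigma> \<and> locally_finite ar \<Sigma> \<and> n_alvin ar \<Sigma> n \<and>
            \<not> m_modular ar \<Sigma> (2 * n - 3))"
proof -
  obtain N where n: "n = 2 * N" and N: "N \<ge> 1"
    using assms by (auto elim!: evenE)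
  have fin: "locally_finite (\<lambda>_. 3) (level_ids J N)" for J
    by (intro locally_finite_identities) simp
  have rev: "\<not> m_reversed_modular (\<lambda>_. 3) (level_ids True N) (2 * n - 1)"
    using level_no_day_chain[OF N, of "2 * n - 1" True]
    by (auto simp: m_reversed_modular_def rev_day_terms_def n)
  have "\<not> m_modular (\<lambda>_. 3) (level_ids True N) (2 * n - 2)"
  proof
    assume "m_modular (\<lambda>_. 3) (level_ids True N) (2 * n - 2)"
    then have "m_reversed_modular (\<lambda>_. 3) (level_ids True N) (Suc (2 * n - 2))"
      by (rule reversed_modular_Suc_if_modular)
    moreover have "Suc (2 * n - 2) = 2 * n - 1" using assms by simp
    ultimately show False using rev by simp
  qed
  moreover have "\<not> m_modular (\<lambda>_. 3) (level_ids False N) (2 * n - 3)"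
    using level_no_day_chain[OF N, of "2 * n - 3" False]
    by (auto simp: m_modular_def day_terms_def n)
  moreover have "n_distributive (\<lambda>_. 3) (level_ids True N) n" "n_alvin (\<lambda>_. 3) (level_ids False N) n"
    using jonsson_terms_level alvin_terms_level by (auto simp: n_distributive_def n_alvin_def n)
  ultimately show ?thesis
    using wf_ids_identities fin rev by blast
qed

end
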